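(* Consider a left-invariant Lorentzian problem on $G=\mathrm{Aff}_+(\mathbb R)$ given by a matrix $A=\begin{pmatrix}a&b\\c&d\end{pmatrix}$, $|A|>0$, and suppose that $K\ge0$, where $K=\frac{c^2-a^2}{|A|^2}$ is its sectional curvature. Then for any points $q_0\in G$ and $q_1\in J^+(q_0)$ there exists a Lorentzian length maximizer from $q_0$ to $q_1$.
   Context: $G=\mathrm{Aff}_+(\mathbb R)=\{(x,y)\in\mathbb R^2: y>0\}$ with product $(x_2,y_2)\cdot(x_1,y_1)=(x_2+y_2x_1,\,y_2y_1)$; left-invariant frame $X_1=y\,\partial_x$, $X_2=y\,\partial_y$. A real matrix $A=\begin{pmatrix}a&b\\c&d\end{pmatrix}$ with $|A|=ad-bc>0$ determines the left-invariant Lorentzian form $g(u_1X_1+u_2X_2)=-v_1^2+v_2^2$, $v_1=au_1+bu_2$, $v_2=cu_1+du_2$, with time orientation in which future directed nonspacelike vectors are those with $v_1\ge|v_2|$. A future directed nonspacelike curve is a Lipschitz curve $q:[0,t_1]\to G$ whose velocity is a.e. of this kind; its Lorentzian length is $l(q)=\int_0^{t_1}\sqrt{v_1^2-v_2^2}\,dt$. $J^+(q_0)$ is the set of endpoints of such curves starting at $q_0$. For $q_1\in J^+(q_0)$ the Lorentzian distance $d(q_0,q_1)$ is the supremum of $l$ over such curves from $q_0$ to $q_1$. A Lorentzian length maximizer from $q_0$ to $q_1$ is such a curve whose length equals this supremum. *)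

theory Defs
  imports "HOL-Analysis.Analysis"
begin

definition Aff_plus :: "(real \<times> real) set" where
  "Aff_plus = {(x, y). y > 0}"

definition aff_mult :: "real \<times> real \<Rightarrow> real \<times> real \<Rightarrow> real \<times> real" where
  "aff_mult p q = (fst p + snd p * fst q, snd p * snd q)"

text \<open>Tangent vectors at a point of \<open>Aff_plus\<close> (an open subset of the plane) are identified
  with elements of \<^typ>\<open>real \<times> real\<close> through the coordinate fields of \<open>x\<close> and \<open>y\<close>.\<close>

definition X1 :: "real \<times> real \<Rightarrow> real \<times> real" where
  "X1 q = (snd q, 0)"

definition X2 :: "real \<times> real \<Rightarrow> real \<times> real" where
  "X2 q = (0, snd q)"

lemma X_left_invariant:
  shows "(aff_mult p has_derivative (\<lambda>w. snd p *\<^sub>R w)) (at q)"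
    and "X1 (aff_mult p q) = snd p *\<^sub>R X1 q"
    and "X2 (aff_mult p q) = snd p *\<^sub>R X2 q"
proof -
  have eq: "aff_mult p = (\<lambda>q. (fst p, 0) + snd p *\<^sub>R q)"
    by (auto simp: aff_mult_def fun_eq_iff)
  show "(aff_mult p has_derivative (\<lambda>w. snd p *\<^sub>R w)) (at q)"
    unfolding eq by (auto intro!: derivative_eq_intros)
  show "X1 (aff_mult p q) = snd p *\<^sub>R X1 q" "X2 (aff_mult p q) = snd p *\<^sub>R X2 q"
    by (auto simp: aff_mult_def X1_def X2_def)
qed

definition frame_coords :: "real \<times> real \<Rightarrow> real \<times> real \<Rightarrow> real^2" where
  "frame_coords q w = vector [fst w / snd q, snd w / snd q]"

lemma frame_coords_iff:
  assumes "q \<in> Aff_plus"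
  shows "frame_coords q w = u \<longleftrightarrow> w = (u$1) *\<^sub>R X1 q + (u$2) *\<^sub>R X2 q"
  using assms
  by (cases w) (auto simp: frame_coords_def Aff_plus_def X1_def X2_def vec_eq_iff forall_2 field_simps)

text \<open>The rows of \<open>A\<close> are \<open>(a, b)\<close> and \<open>(c, d)\<close>, so this is the vector \<open>(v\<^sub>1, v\<^sub>2)\<close> associated
  with the tangent vector \<open>w\<close> at \<open>q\<close>.\<close>

definition v_coords :: "real^2^2 \<Rightarrow> real \<times> real \<Rightarrow> real \<times> real \<Rightarrow> real^2" where
  "v_coords A q w = A *v frame_coords q w"

definition lorentz_form :: "real^2^2 \<Rightarrow> real \<times> real \<Rightarrow> real \<times> real \<Rightarrow> real" where
  "lorentz_form A q w = - (v_coords A q w $ 1)\<^sup>2 + (v_coords A q w $ 2)\<^sup>2"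

definition future_nonspacelike :: "real^2^2 \<Rightarrow> real \<times> real \<Rightarrow> real \<times> real \<Rightarrow> bool" where
  "future_nonspacelike A q w \<longleftrightarrow> v_coords A q w $ 1 \<ge> \<bar>v_coords A q w $ 2\<bar>"

text \<open>For the left-invariant orthonormal frame \<open>e\<^sub>1, e\<^sub>2\<close> dual to \<open>v\<^sub>1, v\<^sub>2\<close> one has
  \<open>[e\<^sub>1, e\<^sub>2] = - (a e\<^sub>1 + c e\<^sub>2) / det A\<close>, and the Koszul formula then gives the constant
  \<open>K = g(R(e\<^sub>1, e\<^sub>2) e\<^sub>2, e\<^sub>1) / (g(e\<^sub>1, e\<^sub>1) g(e\<^sub>2, e\<^sub>2)) = (c\<^sup>2 - a\<^sup>2) / (det A)\<^sup>2\<close>,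
  which is taken as the definition.\<close>

definition sectional_curvature :: "real^2^2 \<Rightarrow> real" where
  "sectional_curvature A = ((A$2$1)\<^sup>2 - (A$1$1)\<^sup>2) / (det A)\<^sup>2"

definition velocity :: "real \<Rightarrow> (real \<Rightarrow> real \<times> real) \<Rightarrow> real \<Rightarrow> real \<times> real" where
  "velocity t1 q t = vector_derivative q (at t within {0..t1})"

text \<open>The Lipschitz condition refers to the Euclidean distance of the plane; on the compact
  image of a curve in \<open>Aff_plus\<close> it is equivalent to the one for any Riemannian distance.\<close>

definition nonspacelike_curve :: "real^2^2 \<Rightarrow> real \<Rightarrow> (real \<Rightarrow> real \<times> real) \<Rightarrow> bool" where
  "nonspacelike_curve A t1 q \<longleftrightarrow>
     0 < t1 \<and> q ` {0..t1} \<subseteq> Aff_plus \<and> (\<exists>L. L-lipschitz_on {0..t1} q) \<and>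
     (AE t in lebesgue_on {0..t1}.
        q differentiable (at t within {0..t1}) \<and> future_nonspacelike A (q t) (velocity t1 q t))"

text \<open>Along a nonspacelike curve the integrand is almost everywhere defined, measurable and
  bounded, so the Lebesgue integral is not a default value.\<close>

definition lorentz_length :: "real^2^2 \<Rightarrow> real \<Rightarrow> (real \<Rightarrow> real \<times> real) \<Rightarrow> real" where
  "lorentz_length A t1 q =
     (LINT t|lebesgue_on {0..t1}. sqrt (- lorentz_form A (q t) (velocity t1 q t)))"

definition nonspacelike_from_to ::
  "real^2^2 \<Rightarrow> real \<times> real \<Rightarrow> real \<times> real \<Rightarrow> real \<Rightarrow> (real \<Rightarrow> real \<times> real) \<Rightarrow> bool" where
  "nonspacelike_from_to A q0 q1 t1 q \<longleftrightarrow> nonspacelike_curve A t1 q \<and> q 0 = q0 \<and> q t1 = q1"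

definition J_plus :: "real^2^2 \<Rightarrow> real \<times> real \<Rightarrow> (real \<times> real) set" where
  "J_plus A q0 = {q1. \<exists>t1 q. nonspacelike_from_to A q0 q1 t1 q}"

text \<open>The supremum is taken in the extended reals, as it may be infinite in general.\<close>

definition lorentz_dist :: "real^2^2 \<Rightarrow> real \<times> real \<Rightarrow> real \<times> real \<Rightarrow> ereal" where
  "lorentz_dist A q0 q1 = Sup {ereal (lorentz_length A t1 q) | t1 q. nonspacelike_from_to A q0 q1 t1 q}"

definition length_maximizer ::
  "real^2^2 \<Rightarrow> real \<times> real \<Rightarrow> real \<times> real \<Rightarrow> real \<Rightarrow> (real \<Rightarrow> real \<times> real) \<Rightarrow> bool" where
  "length_maximizer A q0 q1 t1 q \<longleftrightarrow>
     nonspacelike_from_to A q0 q1 t1 q \<and> ereal (lorentz_length A t1 q) = lorentz_dist A q0 q1"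

end

theory Submission
  imports Defs
begin

text \<open>Write \<open>A\<close> with rows \<open>(a, b)\<close> and \<open>(c, d)\<close>. The linear functions \<open>P = (a + c) x + (b + d) y\<close> and
\<open>M = (a - c) x + (b - d) y\<close> are null coordinates of the whole surface: along a curve
\<open>v\<^sub>1 + v\<^sub>2 = P' / y\<close> and \<open>v\<^sub>1 - v\<^sub>2 = M' / y\<close>, so a curve is future directed nonspacelike iff \<open>P\<close> and \<open>M\<close> are
nondecreasing, and its length is the integral of \<open>sqrt (P' M') / y\<close>. Moreover
\<open>2 det A y = (a - c) P - (a + c) M\<close>, and \<open>K \<ge> 0\<close> says precisely that \<open>a\<^sup>2 \<le> c\<^sup>2\<close>, that is, that the
coefficients of \<open>P\<close> and \<open>M\<close> in this formula do not have opposite signs. Hence \<open>y\<close> is monotone along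
every nonspacelike curve, and curves joining two given points cannot escape to the boundary \<open>y = 0\<close>.

If \<open>P\<close> or \<open>M\<close> takes the same value at \<open>q0\<close> and \<open>q1\<close>, it is constant along every competing curve; all
of them have length zero, and any one of them is a maximizer
(\<open>lorentz_length_eq_0_if_null_constant\<close>).

Otherwise a maximizer can be written down and certified by a calibration, without any compactness
argument. For every positive \<open>f\<close> the inequality between the arithmetic and the geometric mean gives
\<open>sqrt (P' M') / y \<le> (f P' + M' / f) / (2 y)\<close>, with equality iff \<open>M' = f\<^sup>2 P'\<close>. The metric is
invariant under translations in \<open>x\<close>, which suggests a weight \<open>f\<close> that depends on \<open>y\<close> only and makes the
coefficient of \<open>x'\<close> on the right constant: \<open>(a + c) f y + (a - c) / f y = \<Lambda> y\<close>. Then the right-hand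
side is \<open>\<Lambda> / 2 x' + h y y'\<close>, an exact form, so its integral depends on the endpoints only and bounds
the length of every competitor (\<open>lorentz_length_le_calibration\<close>). For \<open>K \<ge> 0\<close> the equation has exactly
one positive solution \<open>f y\<close> as soon as it has one for a single \<open>y\<close> (\<open>slope_function_exists\<close>,
\<open>slope_unique\<close>). The bound is attained by an integral curve of \<open>M' = (f y)\<^sup>2 P'\<close>. In null coordinates these
curves are hyperbolas or lines, and \<open>null_hyperbola\<close> gives the one through two prescribed points
together with its constant \<open>\<Lambda>\<close>.

The competitors are only Lipschitz, so evaluating the integral of the exact form needs the
fundamental theorem of calculus for Lipschitz functions differentiable almost everywhere
(\<open>lipschitz_fundamental_theorem_of_calculus\<close>).\<close>

section \<open>Calculus of Lipschitz functions on an interval\<close>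

lemma DERIV_imp_difference_quotients_tendsto:
  fixes f :: "real \<Rightarrow> real"
  assumes "(f has_real_derivative D) (at x)"
  shows "(\<lambda>n. (f (x + inverse (real (Suc n))) - f x) / inverse (real (Suc n))) \<longlonglongrightarrow> D"
proof -
  have "filterlim (\<lambda>n. inverse (real (Suc n))) (at 0) sequentially"
    by (intro filterlim_atI LIMSEQ_inverse_real_of_nat) auto
  then show ?thesis
    using filterlim_compose[OF assms[unfolded DERIV_def]] by blast
qed

text \<open>The difference quotients are uniformly bounded by the Lipschitz constant and converge to \<open>D\<close>
almost everywhere, so by dominated convergence their integrals converge to that of \<open>D\<close>. In terms of an
antiderivative \<open>K\<close> of an extension of \<open>F\<close>, these integrals are difference quotients of \<open>K\<close> at \<open>b\<close> minus those
at \<open>a\<close>, which converge to \<open>F b - F a\<close>.\<close>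

lemma lipschitz_fundamental_theorem_of_calculus:
  fixes F D :: "real \<Rightarrow> real"
  assumes ab: "a < b" and lip: "L-lipschitz_on {a..b} F"
    and deriv: "AE t in lebesgue_on {a..b}. (F has_real_derivative D t) (at t within {a..b})"
  shows "integrable (lebesgue_on {a..b}) D"
    and "integral\<^sup>L (lebesgue_on {a..b}) D = F b - F a"
proof -
  \<comment> \<open>Extending \<open>F\<close> by constants makes the difference quotients meaningful up to the right endpoint.\<close>
  define G where "G t = F (max a (min b t))" for t
  have L0: "0 \<le> L"
    using lip by (rule lipschitz_on_nonneg)
  have G_lip: "\<bar>G s - G t\<bar> \<le> L * \<bar>s - t\<bar>" for s t
  proof -
    have "\<bar>G s - G t\<bar> \<le> L * \<bar>max a (min b s) - max a (min b t)\<bar>"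
      unfolding G_def using lipschitz_onD[OF lip, of "max a (min b s)" "max a (min b t)"] ab
      by (auto simp: dist_real_def)
    also have "\<dots> \<le> L * \<bar>s - t\<bar>"
      using L0 by (intro mult_left_mono) auto
    finally show ?thesis .
  qed
  have "continuous_on UNIV G"
    by (intro lipschitz_on_continuous_on[of L] lipschitz_onI L0) (use G_lip in \<open>simp add: dist_real_def\<close>)
  then obtain K where K: "(K has_real_derivative G t) (at t)" for t
    using einterval_antiderivative[of "-\<infinity>" "\<infinity>" G]
    by (auto simp: continuous_on_eq_continuous_at has_real_derivative_iff_has_vector_derivative)
  define h where "h n = inverse (real (Suc n))" for n
  have h0: "h n > 0" for n
    by (simp add: h_def)
  define g where "g n t = (G (t + h n) - G t) / h n" for n t
  have g_int: "(g n has_integral (K (b + h n) - K b) / h n - (K (a + h n) - K a) / h n) {a..b}" for n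
  proof -
    have "((\<lambda>t. (K (t + h n) - K t) / h n) has_real_derivative g n t) (at t within {a..b})" for t
      unfolding g_def using h0[of n]
      by (auto intro!: derivative_eq_intros DERIV_chain2[OF K]
          intro: DERIV_subset[OF K])
    from fundamental_theorem_of_calculus[OF less_imp_le[OF ab]
        this[unfolded has_real_derivative_iff_has_vector_derivative]]
    show ?thesis by (simp add: diff_divide_distrib algebra_simps)
  qed
  have g_lim: "(\<lambda>n. integral {a..b} (g n)) \<longlonglongrightarrow> F b - F a"
  proof -
    have "(\<lambda>n. (K (b + h n) - K b) / h n - (K (a + h n) - K a) / h n) \<longlonglongrightarrow> G b - G a"
      unfolding h_def by (intro tendsto_diff DERIV_imp_difference_quotients_tendsto K)
    moreover have "G b = F b" "G a = F a"
      using ab by (auto simp: G_def)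
    ultimately show ?thesis
      using integral_unique[OF g_int] by simp
  qed
  obtain N0 where N0: "N0 \<in> null_sets (lebesgue_on {a..b})"
    "\<And>t. t \<in> {a..b} - N0 \<Longrightarrow> (F has_real_derivative D t) (at t within {a..b})"
    using deriv unfolding eventually_ae_filter by auto
  \<comment> \<open>At the endpoints the one-sided derivatives of \<open>F\<close> need not be derivatives of \<open>G\<close>.\<close>
  define N where "N = N0 \<union> {a, b}"
  have "negligible N0"
    using N0(1) by (simp add: negligible_iff_null_sets null_sets_restrict_space)
  then have N: "negligible N"
    by (simp add: N_def)
  have D: "(\<lambda>n. g n t) \<longlonglongrightarrow> D t" if "t \<in> {a..b} - N" for t
  proof -
    have t: "t \<in> {a<..<b}" "t \<in> {a..b} - N0"
      using that by (auto simp: N_def)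
    have "(F has_real_derivative D t) (at t)"
      using N0(2)[OF t(2)] t(1) by (simp add: at_within_Icc_at)
    then have "(G has_real_derivative D t) (at t)"
      by (rule has_field_derivative_transform_within_open[of _ _ _ "{a<..<b}"]) (use t in \<open>auto simp: G_def\<close>)
    then show ?thesis
      unfolding g_def h_def by (rule DERIV_imp_difference_quotients_tendsto)
  qed
  \<comment> \<open>The dominated convergence theorem used below asks for convergence everywhere.\<close>
  define g' where "g' n t = (if t \<in> N then 0 else g n t)" for n t
  define D' where "D' t = (if t \<in> N then 0 else D t)" for t
  have g'_int: "g' n integrable_on {a..b}" for n
    using integrable_spike[OF has_integral_integrable[OF g_int] N, of "g' n"] by (simp add: g'_def)
  have g'_bound: "norm (g' n t) \<le> L" for n t
    using G_lip[of "t + h n" t] h0[of n] L0 by (auto simp: g'_def g_def field_simps abs_mult)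
  have D'_lim: "(\<lambda>n. g' n t) \<longlonglongrightarrow> D' t" if "t \<in> {a..b}" for t
    using D[of t] that by (auto simp: g'_def D'_def)
  have D': "D' integrable_on {a..b}" "(\<lambda>n. integral {a..b} (g' n)) \<longlonglongrightarrow> integral {a..b} D'"
    using dominated_convergence[OF g'_int integrable_const_ivl[of L] _ D'_lim] g'_bound by auto
  have "norm (D' t) \<le> L" if "t \<in> {a..b}" for t
    using g'_bound by (intro Lim_bounded[OF tendsto_norm[OF D'_lim[OF that]]]) auto
  then have "D' absolutely_integrable_on {a..b}"
    by (rule absolutely_integrable_integrable_bound[OF _ D'(1) integrable_const_ivl])
  then have "D absolutely_integrable_on {a..b}"
    using N by (rule absolutely_integrable_spike) (auto simp: D'_def)
  then show int: "integrable (lebesgue_on {a..b}) D"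
    by (rule absolutely_integrable_imp_integrable) auto
  have "integral {a..b} (g' n) = integral {a..b} (g n)" for n
    by (rule integral_spike[OF N]) (auto simp: g'_def)
  then have "integral {a..b} D' = F b - F a"
    using LIMSEQ_unique[OF D'(2)] g_lim by simp
  moreover have "integral {a..b} D' = integral {a..b} D"
    by (rule integral_spike[OF N]) (auto simp: D'_def)
  ultimately show "integral\<^sup>L (lebesgue_on {a..b}) D = F b - F a"
    using lebesgue_integral_eq_integral[OF int] by simp
qed

lemma C1_imp_lipschitz_on_Icc:
  fixes H h :: "real \<Rightarrow> real"
  assumes deriv: "\<And>y. y \<in> {a..b} \<Longrightarrow> (H has_real_derivative h y) (at y within {a..b})"
    and cont: "continuous_on {a..b} h"
  shows "\<exists>C. C-lipschitz_on {a..b} H"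
proof -
  have "bounded (h ` {a..b})"
    using cont by (intro compact_imp_bounded compact_continuous_image) auto
  then obtain C where C: "C > 0" "\<And>y. y \<in> {a..b} \<Longrightarrow> \<bar>h y\<bar> \<le> C"
    by (auto simp: bounded_pos)
  have "C-lipschitz_on {a..b} H"
  proof (rule bounded_derivative_imp_lipschitz)
    show "(H has_derivative (*) (h y)) (at y within {a..b})" if "y \<in> {a..b}" for y
      using deriv[OF that] by (simp add: has_field_derivative_def)
    show "onorm ((*) (h y)) \<le> C" if "y \<in> {a..b}" for y
      using C(2)[OF that] by (intro onorm_bound) (auto simp: abs_mult intro: mult_right_mono less_imp_le[OF C(1)])
  qed (use C in auto)
  then show ?thesis ..
qed

section \<open>Null coordinates and lengths of curves\<close>

definition null_sum :: "real^2^2 \<Rightarrow> real \<times> real \<Rightarrow> real" where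
  "null_sum A w = (A$1$1 + A$2$1) * fst w + (A$1$2 + A$2$2) * snd w"

definition null_diff :: "real^2^2 \<Rightarrow> real \<times> real \<Rightarrow> real" where
  "null_diff A w = (A$1$1 - A$2$1) * fst w + (A$1$2 - A$2$2) * snd w"

lemma v_coords_null:
  "v_coords A q w $ 1 + v_coords A q w $ 2 = null_sum A w / snd q"
  "v_coords A q w $ 1 - v_coords A q w $ 2 = null_diff A w / snd q"
  by (simp_all add: v_coords_def frame_coords_def matrix_vector_mult_def sum_2 null_sum_def
      null_diff_def add_divide_distrib diff_divide_distrib algebra_simps)

lemma future_nonspacelike_iff_null:
  assumes "q \<in> Aff_plus"
  shows "future_nonspacelike A q w \<longleftrightarrow> 0 \<le> null_sum A w \<and> 0 \<le> null_diff A w"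
proof -
  have "future_nonspacelike A q w \<longleftrightarrow>
    0 \<le> v_coords A q w $ 1 + v_coords A q w $ 2 \<and> 0 \<le> v_coords A q w $ 1 - v_coords A q w $ 2"
    by (auto simp: future_nonspacelike_def)
  then show ?thesis
    unfolding v_coords_null using assms by (auto simp: Aff_plus_def zero_le_divide_iff)
qed

lemma lorentz_form_null:
  "- lorentz_form A q w = null_sum A w * null_diff A w / (snd q)\<^sup>2"
proof -
  have "- lorentz_form A q w =
      (v_coords A q w $ 1 + v_coords A q w $ 2) * (v_coords A q w $ 1 - v_coords A q w $ 2)"
    by (simp add: lorentz_form_def power2_eq_square algebra_simps)
  then show ?thesis
    unfolding v_coords_null by (simp add: power2_eq_square)
qed

text \<open>The form \<open>c dx + h y dy\<close> is the differential of \<open>c x + H y\<close>. Since \<open>y\<close> stays in a compact subinterval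
of the positive reals, \<open>H\<close> is Lipschitz on its range, so the potential is Lipschitz along the curve
although \<open>h\<close> may be unbounded near \<open>0\<close>.\<close>

lemma nonspacelike_curve_integral_exact:
  assumes curve: "nonspacelike_curve A t1 q"
    and deriv: "\<And>y. y > 0 \<Longrightarrow> (H has_real_derivative h y) (at y)"
    and cont: "continuous_on {0<..} h"
  shows "integrable (lebesgue_on {0..t1})
      (\<lambda>t. c * fst (velocity t1 q t) + h (snd (q t)) * snd (velocity t1 q t))"
    and "(LINT t|lebesgue_on {0..t1}. c * fst (velocity t1 q t) + h (snd (q t)) * snd (velocity t1 q t))
      = (c * fst (q t1) + H (snd (q t1))) - (c * fst (q 0) + H (snd (q 0)))"
proof -
  obtain L where t1: "0 < t1" and img: "q ` {0..t1} \<subseteq> Aff_plus" and L: "L-lipschitz_on {0..t1} q"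
    and ae: "AE t in lebesgue_on {0..t1}.
      q differentiable (at t within {0..t1}) \<and> future_nonspacelike A (q t) (velocity t1 q t)"
    using curve by (auto simp: nonspacelike_curve_def)
  have pos: "snd (q t) > 0" if "t \<in> {0..t1}" for t
    using img that by (fastforce simp: Aff_plus_def)
  have fst_lip: "L-lipschitz_on {0..t1} (\<lambda>t. fst (q t))" and snd_lip: "L-lipschitz_on {0..t1} (\<lambda>t. snd (q t))"
    using L dist_fst_le[of "q _" "q _"] dist_snd_le[of "q _" "q _"]
    unfolding lipschitz_on_def by (meson order_trans)+
  let ?Y = "(\<lambda>t. snd (q t)) ` {0..t1}"
  have "compact ?Y"
    using lipschitz_on_continuous_on[OF snd_lip] by (intro compact_continuous_image) auto
  moreover have "?Y \<noteq> {}"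
    using t1 by auto
  ultimately obtain m B where m: "m \<in> ?Y" and Y: "?Y \<subseteq> {m..B}"
    by (metis atLeastAtMost_iff compact_attains_inf compact_attains_sup subsetI)
  have m0: "m > 0"
    using m pos by auto
  have "\<exists>C. C-lipschitz_on {m..B} H"
    by (rule C1_imp_lipschitz_on_Icc[of m B H h])
      (use m0 in \<open>auto intro!: DERIV_subset[OF deriv] continuous_on_subset[OF cont]\<close>)
  then obtain C where C: "C-lipschitz_on {m..B} H" ..
  let ?F = "\<lambda>t. c * fst (q t) + H (snd (q t))"
  have lip: "(\<bar>c\<bar> * L + C * L)-lipschitz_on {0..t1} ?F"
    by (intro lipschitz_on_add lipschitz_on_cmult_real fst_lip
        lipschitz_on_compose2[OF snd_lip] lipschitz_on_subset[OF C] Y)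
  have ae': "AE t in lebesgue_on {0..t1}. (?F has_real_derivative
      c * fst (velocity t1 q t) + h (snd (q t)) * snd (velocity t1 q t)) (at t within {0..t1})"
    using ae AE_space
  proof eventually_elim
    case (elim t)
    have q: "(q has_vector_derivative velocity t1 q t) (at t within {0..t1})"
      using elim by (auto simp: velocity_def vector_derivative_works)
    have f: "((\<lambda>t. fst (q t)) has_real_derivative fst (velocity t1 q t)) (at t within {0..t1})"
      and s: "((\<lambda>t. snd (q t)) has_real_derivative snd (velocity t1 q t)) (at t within {0..t1})"
      using has_derivative_fst[OF q[unfolded has_vector_derivative_def]]
        has_derivative_snd[OF q[unfolded has_vector_derivative_def]]
      by (simp_all add: has_field_derivative_def mult_commute_abs)
    have "((\<lambda>t. H (snd (q t))) has_real_derivative h (snd (q t)) * snd (velocity t1 q t)) (at t within {0..t1})"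
      using elim by (intro DERIV_chain2[OF deriv s] pos) auto
    then show ?case
      by (intro DERIV_add DERIV_cmult f)
  qed
  show "integrable (lebesgue_on {0..t1})
      (\<lambda>t. c * fst (velocity t1 q t) + h (snd (q t)) * snd (velocity t1 q t))"
    "(LINT t|lebesgue_on {0..t1}. c * fst (velocity t1 q t) + h (snd (q t)) * snd (velocity t1 q t))
      = ?F t1 - ?F 0"
    by (rule lipschitz_fundamental_theorem_of_calculus[OF t1 lip ae'])+
qed

lemma nonspacelike_curve_AE_null_nonneg:
  assumes "nonspacelike_curve A t1 q"
  shows "AE t in lebesgue_on {0..t1}. q t \<in> Aff_plus \<and>
    0 \<le> null_sum A (velocity t1 q t) \<and> 0 \<le> null_diff A (velocity t1 q t)"
proof -
  have img: "q ` {0..t1} \<subseteq> Aff_plus"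
    and ae: "AE t in lebesgue_on {0..t1}.
      q differentiable (at t within {0..t1}) \<and> future_nonspacelike A (q t) (velocity t1 q t)"
    using assms by (auto simp: nonspacelike_curve_def)
  show ?thesis
    using ae AE_space
  proof eventually_elim
    case (elim t)
    then have "q t \<in> Aff_plus"
      using img by auto
    then show ?case
      using elim future_nonspacelike_iff_null by blast
  qed
qed

lemma nonspacelike_curve_integral_null:
  assumes "nonspacelike_from_to A q0 q1 t1 q"
  shows "integrable (lebesgue_on {0..t1}) (\<lambda>t. null_sum A (velocity t1 q t))"
    and "(LINT t|lebesgue_on {0..t1}. null_sum A (velocity t1 q t)) = null_sum A q1 - null_sum A q0"
    and "integrable (lebesgue_on {0..t1}) (\<lambda>t. null_diff A (velocity t1 q t))"
    and "(LINT t|lebesgue_on {0..t1}. null_diff A (velocity t1 q t)) = null_diff A q1 - null_diff A q0"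
  using assms nonspacelike_curve_integral_exact[of A t1 q "\<lambda>y. k * y" "\<lambda>_. k" c for k c]
  by (auto simp: nonspacelike_from_to_def null_sum_def null_diff_def intro!: derivative_eq_intros)

lemma nonspacelike_from_to_null_mono:
  assumes "nonspacelike_from_to A q0 q1 t1 q"
  shows "null_sum A q0 \<le> null_sum A q1" and "null_diff A q0 \<le> null_diff A q1"
proof -
  have ae: "AE t in lebesgue_on {0..t1}. 0 \<le> null_sum A (velocity t1 q t)"
    "AE t in lebesgue_on {0..t1}. 0 \<le> null_diff A (velocity t1 q t)"
    using nonspacelike_curve_AE_null_nonneg assms unfolding nonspacelike_from_to_def
    by (auto elim!: eventually_mono)
  show "null_sum A q0 \<le> null_sum A q1" "null_diff A q0 \<le> null_diff A q1"
    using nonspacelike_curve_integral_null[OF assms] integral_nonneg_AE[OF ae(1)] integral_nonneg_AE[OF ae(2)]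
    by auto
qed

text \<open>The rate of change of the null coordinate with equal end values is nonnegative with integral zero, so
it vanishes almost everywhere, and with it the length element.\<close>

lemma lorentz_length_eq_0_if_null_constant:
  assumes curve: "nonspacelike_from_to A q0 q1 t1 q"
    and const: "null_sum A q1 = null_sum A q0 \<or> null_diff A q1 = null_diff A q0"
  shows "lorentz_length A t1 q = 0"
proof -
  have ae: "AE t in lebesgue_on {0..t1}. 0 \<le> null_sum A (velocity t1 q t)"
    "AE t in lebesgue_on {0..t1}. 0 \<le> null_diff A (velocity t1 q t)"
    using nonspacelike_curve_AE_null_nonneg curve unfolding nonspacelike_from_to_def
    by (auto elim!: eventually_mono)
  note int = nonspacelike_curve_integral_null[OF curve]
  have "(AE t in lebesgue_on {0..t1}. null_sum A (velocity t1 q t) = 0) \<or>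
    (AE t in lebesgue_on {0..t1}. null_diff A (velocity t1 q t) = 0)"
    using const integral_nonneg_eq_0_iff_AE[OF int(1) ae(1)] integral_nonneg_eq_0_iff_AE[OF int(3) ae(2)]
      int(2,4) by auto
  then have "AE t in lebesgue_on {0..t1}. sqrt (- lorentz_form A (q t) (velocity t1 q t)) = 0"
    unfolding lorentz_form_null by (auto elim!: eventually_mono)
  then show ?thesis
    unfolding lorentz_length_def by (rule integral_eq_zero_AE)
qed

lemma length_maximizerI:
  assumes "nonspacelike_from_to A q0 q1 t1 q"
    and "\<And>t2 r. nonspacelike_from_to A q0 q1 t2 r \<Longrightarrow> lorentz_length A t2 r \<le> lorentz_length A t1 q"
  shows "length_maximizer A q0 q1 t1 q"
  using assms unfolding length_maximizer_def lorentz_dist_def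
  by (auto intro!: antisym Sup_upper Sup_least)

text \<open>A potential whose differential dominates the length element on every future directed nonspacelike
vector bounds all lengths between two points at once.\<close>

lemma lorentz_length_le_calibration:
  assumes curve: "nonspacelike_from_to A q0 q1 t1 q"
    and deriv: "\<And>y. y > 0 \<Longrightarrow> (H has_real_derivative h y) (at y)"
    and cont: "continuous_on {0<..} h"
    and le: "\<And>p w. p \<in> Aff_plus \<Longrightarrow> 0 \<le> null_sum A w \<Longrightarrow> 0 \<le> null_diff A w \<Longrightarrow>
      sqrt (- lorentz_form A p w) \<le> c * fst w + h (snd p) * snd w"
  shows "lorentz_length A t1 q \<le> (c * fst q1 + H (snd q1)) - (c * fst q0 + H (snd q0))"
proof -
  let ?S = "\<lambda>t. c * fst (velocity t1 q t) + h (snd (q t)) * snd (velocity t1 q t)"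
  have q: "nonspacelike_curve A t1 q" "q 0 = q0" "q t1 = q1"
    using curve by (auto simp: nonspacelike_from_to_def)
  have ae: "AE t in lebesgue_on {0..t1}. sqrt (- lorentz_form A (q t) (velocity t1 q t)) \<le> ?S t"
    using nonspacelike_curve_AE_null_nonneg[OF q(1)] by eventually_elim (use le in auto)
  have "AE t in lebesgue_on {0..t1}. 0 \<le> sqrt (- lorentz_form A (q t) (velocity t1 q t))"
    using nonspacelike_curve_AE_null_nonneg[OF q(1)]
    by eventually_elim (auto simp: lorentz_form_null)
  with ae have "AE t in lebesgue_on {0..t1}. 0 \<le> ?S t"
    by eventually_elim (rule order_trans)
  then show ?thesis
    using integral_mono_AE'[OF nonspacelike_curve_integral_exact(1)[OF q(1) deriv cont] ae]
      nonspacelike_curve_integral_exact(2)[OF q(1) deriv cont] q(2,3)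
    unfolding lorentz_length_def by simp
qed

section \<open>Null hyperbolas and the calibration weight\<close>

text \<open>Measured from the starting point, the increments of the null coordinates along the arc are \<open>t\<close> and
\<open>\<kappa>\<^sup>2 t / (1 + \<theta> t)\<close>, and \<open>y\<close> equals \<open>y0 + \<eta> t + \<zeta> (\<kappa>\<^sup>2 t / (1 + \<theta> t))\<close>. The slope \<open>dM/dP\<close> is the square of
\<open>\<kappa> / (1 + \<theta> t)\<close>, and the last conclusion says that this root satisfies the equation of the calibration
weight along the whole arc. For \<open>\<theta> = 0\<close> the arc is a segment, otherwise part of a hyperbola; the same
formula serves when \<open>\<eta>\<close> or \<open>\<zeta>\<close> vanishes, which is the flat case.\<close>

lemma null_hyperbola:
  fixes \<eta> \<zeta> y0 p m :: real
  assumes sgn: "0 \<le> \<eta> * \<zeta>" and y0: "0 < y0" and p: "0 < p" and m: "0 < m"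
    and y1: "0 < y0 + \<eta> * p + \<zeta> * m"
  obtains \<kappa> \<theta> where "0 < \<kappa>"
    and "\<And>t. t \<in> {0..p} \<Longrightarrow> 0 < 1 + \<theta> * t"
    and "\<kappa>\<^sup>2 * p / (1 + \<theta> * p) = m"
    and "\<And>t. t \<in> {0..p} \<Longrightarrow> 0 < y0 + \<eta> * t + \<zeta> * (\<kappa>\<^sup>2 * t / (1 + \<theta> * t))"
    and "\<And>t. t \<in> {0..p} \<Longrightarrow> \<zeta> * (\<kappa> / (1 + \<theta> * t)) - \<eta> / (\<kappa> / (1 + \<theta> * t))
      = - (\<theta> / \<kappa>) * (y0 + \<eta> * t + \<zeta> * (\<kappa>\<^sup>2 * t / (1 + \<theta> * t)))"
proof -
  have signs: "0 \<le> \<eta> \<and> 0 \<le> \<zeta> \<or> \<eta> \<le> 0 \<and> \<zeta> \<le> 0"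
    using sgn by (auto simp: zero_le_mult_iff)
  define a where "a = y0 + \<eta> * p"
  define b where "b = y0 + \<zeta> * m"
  have "0 \<le> \<eta> * p \<and> 0 \<le> \<zeta> * m \<or> \<eta> * p \<le> 0 \<and> \<zeta> * m \<le> 0"
    using signs p m by (auto simp: mult_nonpos_nonneg)
  then have ab: "0 < a" "0 < b"
    using y0 y1 by (auto simp: a_def b_def)
  \<comment> \<open>The slope equation at \<open>t = 0\<close> reads \<open>\<theta> y0 = \<eta> - \<zeta> \<kappa>\<^sup>2\<close>;
    inserting this into the endpoint condition leaves a linear equation for \<open>\<kappa>\<^sup>2\<close>.\<close>
  define \<kappa> where "\<kappa> = sqrt (m * a / (p * b))"
  define \<theta> where "\<theta> = (\<eta> - \<zeta> * \<kappa>\<^sup>2) / y0"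
  have \<kappa>: "0 < \<kappa>" and \<kappa>2: "\<kappa>\<^sup>2 = m * a / (p * b)"
    using ab p m by (auto simp: \<kappa>_def)
  have \<theta>: "\<theta> * y0 = \<eta> - \<zeta> * \<kappa>\<^sup>2"
    using y0 by (simp add: \<theta>_def)
  have gp: "1 + \<theta> * p = a / b"
  proof -
    have "y0 * (1 + \<theta> * p) = a - \<zeta> * (\<kappa>\<^sup>2 * p)"
      using \<theta> unfolding a_def by algebra
    also have "\<dots> = a * (b - \<zeta> * m) / b"
      using p ab by (simp add: \<kappa>2 field_simps)
    also have "\<dots> = y0 * (a / b)"
      by (simp add: b_def)
    finally show ?thesis
      using y0 unfolding mult_cancel_left by simp
  qed
  have g: "0 < 1 + \<theta> * t" if t: "t \<in> {0..p}" for t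
  proof -
    have "p * (1 + \<theta> * t) = (p - t) + t * (1 + \<theta> * p)"
      by (simp add: algebra_simps)
    also have "\<dots> > 0"
      using t p ab unfolding gp by (cases "t = p") (auto intro: add_pos_nonneg)
    finally show ?thesis
      using p by (simp add: zero_less_mult_iff)
  qed
  have m_eq: "\<kappa>\<^sup>2 * p / (1 + \<theta> * p) = m"
    unfolding gp \<kappa>2 using ab p by simp
  have y: "0 < y0 + \<eta> * t + \<zeta> * (\<kappa>\<^sup>2 * t / (1 + \<theta> * t))" if t: "t \<in> {0..p}" for t
  proof -
    let ?\<mu> = "\<kappa>\<^sup>2 * t / (1 + \<theta> * t)"
    have "0 \<le> ?\<mu>"
      using g[OF t] t by simp
    have "t / (1 + \<theta> * t) \<le> p / (1 + \<theta> * p)"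
      using g[OF t] g[of p] p t by (simp add: pos_divide_le_eq pos_le_divide_eq algebra_simps)
    then have "?\<mu> \<le> \<kappa>\<^sup>2 * p / (1 + \<theta> * p)"
      using mult_left_mono[of _ _ "\<kappa>\<^sup>2"] by fastforce
    then have "?\<mu> \<le> m"
      using m_eq by simp
    show ?thesis
    proof (cases "0 \<le> \<eta> \<and> 0 \<le> \<zeta>")
      case True
      then show ?thesis
        using \<open>0 \<le> ?\<mu>\<close> t y0 by (intro add_pos_nonneg mult_nonneg_nonneg) auto
    next
      case False
      then have "\<eta> * p \<le> \<eta> * t" "\<zeta> * m \<le> \<zeta> * ?\<mu>"
        using signs t \<open>?\<mu> \<le> m\<close> by (intro mult_left_mono_neg; force)+
      then show ?thesis
        using y1 by linarith
    qed
  qed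
  have slope: "\<zeta> * (\<kappa> / (1 + \<theta> * t)) - \<eta> / (\<kappa> / (1 + \<theta> * t))
      = - (\<theta> / \<kappa>) * (y0 + \<eta> * t + \<zeta> * (\<kappa>\<^sup>2 * t / (1 + \<theta> * t)))" if t: "t \<in> {0..p}" for t
  proof -
    define g where "g = 1 + \<theta> * t"
    have g0: "g \<noteq> 0"
      using g[OF t] by (simp add: g_def)
    have "\<zeta> * \<kappa>\<^sup>2 - \<eta> * g\<^sup>2 = - \<theta> * (y0 * g + \<eta> * t * g + \<zeta> * \<kappa>\<^sup>2 * t)"
      using \<theta> unfolding g_def by algebra
    moreover have "\<zeta> * (\<kappa> / g) - \<eta> / (\<kappa> / g) = (\<zeta> * \<kappa>\<^sup>2 - \<eta> * g\<^sup>2) / (\<kappa> * g)"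
      using g0 \<kappa> by (simp add: field_simps power2_eq_square)
    moreover have "- (\<theta> / \<kappa>) * (y0 + \<eta> * t + \<zeta> * (\<kappa>\<^sup>2 * t / g))
        = - \<theta> * (y0 * g + \<eta> * t * g + \<zeta> * \<kappa>\<^sup>2 * t) / (\<kappa> * g)"
      using g0 \<kappa> by (simp add: field_simps power2_eq_square)
    ultimately have "\<zeta> * (\<kappa> / g) - \<eta> / (\<kappa> / g) = - (\<theta> / \<kappa>) * (y0 + \<eta> * t + \<zeta> * (\<kappa>\<^sup>2 * t / g))"
      by simp
    then show ?thesis
      by (simp add: g_def)
  qed
  show ?thesis
    using that[OF \<kappa> g m_eq y slope] by blast
qed

text \<open>Since \<open>\<alpha>\<close> and \<open>\<gamma>\<close> do not have the same sign, \<open>\<alpha> f + \<gamma> / f\<close> is strictly monotone in \<open>f > 0\<close>.\<close>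

lemma slope_unique:
  fixes \<alpha> \<gamma> f f' :: real
  assumes "\<alpha> * \<gamma> \<le> 0" "\<alpha> \<noteq> 0 \<or> \<gamma> \<noteq> 0" "0 < f" "0 < f'"
    and eq: "\<alpha> * f + \<gamma> / f = \<alpha> * f' + \<gamma> / f'"
  shows "f = f'"
proof -
  have "(f - f') * (\<alpha> * (f * f') - \<gamma>) = 0"
    using eq assms(3,4) by (simp add: field_simps)
  moreover have "\<alpha> * (f * f') - \<gamma> \<noteq> 0"
  proof
    assume "\<alpha> * (f * f') - \<gamma> = 0"
    then have \<gamma>: "\<gamma> = \<alpha> * (f * f')"
      by simp
    then have "\<alpha>\<^sup>2 * (f * f') \<le> 0"
      using assms(1) by (simp add: power2_eq_square mult.assoc)
    then have "\<alpha> = 0"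
      using assms(3,4) by (simp add: mult_le_0_iff)
    then show False
      using \<gamma> assms(2) by simp
  qed
  ultimately show ?thesis
    by simp
qed

text \<open>If both coefficients are nonzero, \<open>f\<close> is the positive root of \<open>\<alpha> f\<^sup>2 - \<Lambda> y f + \<gamma> = 0\<close>, which exists for
every \<open>\<Lambda>\<close>. If one of them vanishes, a positive solution exists only for one sign of \<open>\<Lambda>\<close>; this is why
one solution \<open>\<kappa>\<close> at \<open>y0\<close> is assumed.\<close>

lemma slope_function_exists:
  fixes \<alpha> \<gamma> \<Lambda> y0 \<kappa> :: real
  assumes sgn: "\<alpha> * \<gamma> \<le> 0" and nz: "\<alpha> \<noteq> 0 \<or> \<gamma> \<noteq> 0" and pos: "0 < y0" "0 < \<kappa>"
    and init: "\<alpha> * \<kappa> + \<gamma> / \<kappa> = \<Lambda> * y0"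
  obtains f where "continuous_on {0<..} f" and "\<And>y. 0 < y \<Longrightarrow> 0 < f y"
    and "\<And>y. 0 < y \<Longrightarrow> \<alpha> * f y + \<gamma> / f y = \<Lambda> * y"
proof -
  consider "\<gamma> = 0" "\<alpha> \<noteq> 0" | "\<alpha> = 0" "\<gamma> \<noteq> 0" | "\<alpha> * \<gamma> < 0"
    using sgn nz by force
  then show ?thesis
  proof cases
    case 1
    have \<Lambda>: "\<Lambda> = \<alpha> * \<kappa> / y0"
      using init 1 pos by (simp add: field_simps)
    show ?thesis
      by (rule that[of "\<lambda>y. \<kappa> * y / y0"]) (use 1 pos \<Lambda> in \<open>auto intro!: continuous_intros\<close>)
  next
    case 2
    have \<Lambda>: "\<Lambda> = \<gamma> / (\<kappa> * y0)"
      using init 2 pos by (simp add: field_simps)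
    show ?thesis
      by (rule that[of "\<lambda>y. \<kappa> * y0 / y"]) (use 2 pos \<Lambda> in \<open>auto intro!: continuous_intros\<close>)
  next
    case 3
    then have \<alpha>: "\<alpha> \<noteq> 0"
      by auto
    define r where "r y = sqrt ((\<Lambda> * y)\<^sup>2 - 4 * \<alpha> * \<gamma>)" for y
    have r2: "(r y)\<^sup>2 = (\<Lambda> * y)\<^sup>2 - 4 * \<alpha> * \<gamma>" for y
      using 3 zero_le_power2[of "\<Lambda> * y"] unfolding r_def mult.assoc[of 4]
      by (intro real_sqrt_pow2) linarith
    have r: "\<bar>\<Lambda> * y\<bar> < r y" for y
      unfolding r_def using 3 by (intro real_less_rsqrt) (simp add: mult.assoc)
    define f where "f y = (\<Lambda> * y + sgn \<alpha> * r y) / (2 * \<alpha>)" for y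
    have f: "0 < f y" for y
      using r[of y] \<alpha> by (cases "\<alpha> > 0") (auto simp: f_def divide_neg_neg)
    have "\<alpha> * f y + \<gamma> / f y = \<Lambda> * y" for y
    proof -
      have "2 * \<alpha> * f y - \<Lambda> * y = sgn \<alpha> * r y"
        using \<alpha> by (simp add: f_def)
      then have "(2 * \<alpha> * f y - \<Lambda> * y)\<^sup>2 = (r y)\<^sup>2"
        using \<alpha> by (simp add: power_mult_distrib sgn_if)
      then have "4 * \<alpha> * (\<alpha> * (f y)\<^sup>2 + \<gamma> - \<Lambda> * y * f y) = 0"
        unfolding r2 by (simp add: power2_eq_square algebra_simps)
      then have "\<alpha> * (f y)\<^sup>2 + \<gamma> = \<Lambda> * y * f y"
        using \<alpha> by simp
      then show ?thesis
        using f[of y] by (simp add: field_simps power2_eq_square)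
    qed
    moreover have "continuous_on {0<..} f"
      unfolding f_def r_def using \<alpha> by (auto intro!: continuous_intros)
    ultimately show ?thesis
      using that f by blast
  qed
qed

section \<open>Existence of maximizers\<close>

lemma det_null: "(A$1$2 + A$2$2) * (A$1$1 - A$2$1) - (A$1$1 + A$2$1) * (A$1$2 - A$2$2) = 2 * det (A::real^2^2)"
  by (simp add: det_2 algebra_simps)

text \<open>The curvature enters only through this sign: it makes \<open>2 det A y = (a - c) P - (a + c) M\<close> monotone along
nonspacelike curves.\<close>

lemma curvature_null:
  assumes "det A > 0" "sectional_curvature A \<ge> 0"
  shows "(A$1$1 + A$2$1) * (A$1$1 - A$2$1) \<le> 0"
proof -
  have "0 < (det A)\<^sup>2"
    using assms(1) by simp
  then have "(A$1$1)\<^sup>2 \<le> (A$2$1)\<^sup>2"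
    using assms(2) by (simp add: sectional_curvature_def zero_le_divide_iff del: zero_less_power2)
  then show ?thesis
    by (simp add: power2_eq_square algebra_simps)
qed

text \<open>The arc of \<open>null_hyperbola\<close>, transported back to the coordinates \<open>x\<close> and \<open>y\<close>, is an integral curve of the
calibration weight with the same constant \<open>\<Lambda>\<close>. Along it the arithmetic-geometric inequality is an equality,
so its length equals the upper bound for all lengths.\<close>

lemma length_maximizer_if_null_increasing:
  fixes A :: "real^2^2" and q0 q1 :: "real \<times> real"
  assumes detA: "det A > 0" and K: "sectional_curvature A \<ge> 0"
    and q0: "q0 \<in> Aff_plus" and q1: "q1 \<in> Aff_plus"
    and P: "null_sum A q0 < null_sum A q1" and M: "null_diff A q0 < null_diff A q1"
  shows "\<exists>t1 q. length_maximizer A q0 q1 t1 q"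
proof -
  define \<alpha> where "\<alpha> = A$1$1 + A$2$1"
  define \<beta> where "\<beta> = A$1$2 + A$2$2"
  define \<gamma> where "\<gamma> = A$1$1 - A$2$1"
  define \<delta> where "\<delta> = A$1$2 - A$2$2"
  define D where "D = 2 * det A"
  have D: "D > 0" and D_eq: "\<beta> * \<gamma> - \<alpha> * \<delta> = D"
    using detA det_null[of A] by (auto simp: D_def \<alpha>_def \<beta>_def \<gamma>_def \<delta>_def)
  have sgn: "\<alpha> * \<gamma> \<le> 0"
    using curvature_null[OF detA K] by (simp add: \<alpha>_def \<gamma>_def)
  have nz: "\<alpha> \<noteq> 0 \<or> \<gamma> \<noteq> 0"
    using D D_eq by auto
  have ns: "null_sum A w = \<alpha> * fst w + \<beta> * snd w" and nd: "null_diff A w = \<gamma> * fst w + \<delta> * snd w" for w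
    by (simp_all add: null_sum_def null_diff_def \<alpha>_def \<beta>_def \<gamma>_def \<delta>_def)
  define \<eta> where "\<eta> = \<gamma> / D"
  define \<zeta> where "\<zeta> = - \<alpha> / D"
  define p where "p = null_sum A q1 - null_sum A q0"
  define m where "m = null_diff A q1 - null_diff A q0"
  have p: "0 < p" and m: "0 < m"
    using P M by (auto simp: p_def m_def)
  have y0: "0 < snd q0" and y1: "0 < snd q1"
    using q0 q1 by (auto simp: Aff_plus_def)
  have xy1: "fst q1 = fst q0 + (\<beta> * m - \<delta> * p) / D" "snd q1 = snd q0 + \<eta> * p + \<zeta> * m"
  proof -
    have "\<beta> * m - \<delta> * p = D * (fst q1 - fst q0)" "\<gamma> * p - \<alpha> * m = D * (snd q1 - snd q0)"
      unfolding p_def m_def ns nd D_eq[symmetric] by algebra+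
    then show "fst q1 = fst q0 + (\<beta> * m - \<delta> * p) / D" "snd q1 = snd q0 + \<eta> * p + \<zeta> * m"
      using D by (simp_all add: \<eta>_def \<zeta>_def field_simps)
  qed
  have \<eta>\<zeta>: "0 \<le> \<eta> * \<zeta>"
    using sgn D by (simp add: \<eta>_def \<zeta>_def mult.commute divide_nonpos_pos)
  obtain \<kappa> \<theta> where \<kappa>: "0 < \<kappa>"
    and g: "\<And>t. t \<in> {0..p} \<Longrightarrow> 0 < 1 + \<theta> * t"
    and m_eq: "\<kappa>\<^sup>2 * p / (1 + \<theta> * p) = m"
    and Y: "\<And>t. t \<in> {0..p} \<Longrightarrow> 0 < snd q0 + \<eta> * t + \<zeta> * (\<kappa>\<^sup>2 * t / (1 + \<theta> * t))"
    and slope: "\<And>t. t \<in> {0..p} \<Longrightarrow> \<zeta> * (\<kappa> / (1 + \<theta> * t)) - \<eta> / (\<kappa> / (1 + \<theta> * t))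
      = - (\<theta> / \<kappa>) * (snd q0 + \<eta> * t + \<zeta> * (\<kappa>\<^sup>2 * t / (1 + \<theta> * t)))"
    using null_hyperbola[OF \<eta>\<zeta> y0 p m] y1 unfolding xy1(2) by metis
  \<comment> \<open>The arc is parametrized by the increment \<open>t\<close> of \<open>P\<close>; then \<open>\<mu>\<close> is the increment of \<open>M\<close>,
    \<open>\<phi>\<close> the square root of its derivative, and \<open>w\<close> the velocity.\<close>
  define \<mu> where "\<mu> t = \<kappa>\<^sup>2 * t / (1 + \<theta> * t)" for t
  define \<phi> where "\<phi> t = \<kappa> / (1 + \<theta> * t)" for t
  define q where "q t = (fst q0 + (\<beta> * \<mu> t - \<delta> * t) / D, snd q0 + \<eta> * t + \<zeta> * \<mu> t)" for t
  define w where "w t = ((\<beta> * (\<phi> t)\<^sup>2 - \<delta>) / D, \<eta> + \<zeta> * (\<phi> t)\<^sup>2)" for t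
  define \<Lambda> where "\<Lambda> = D * (\<theta> / \<kappa>)"
  have \<phi>: "0 < \<phi> t" if "t \<in> {0..p}" for t
    using g[OF that] \<kappa> by (simp add: \<phi>_def)
  have slope': "\<alpha> * \<phi> t + \<gamma> / \<phi> t = \<Lambda> * snd (q t)" if "t \<in> {0..p}" for t
  proof -
    have "\<alpha> * \<phi> t + \<gamma> / \<phi> t = - D * (\<zeta> * \<phi> t - \<eta> / \<phi> t)"
      using D by (simp add: \<eta>_def \<zeta>_def algebra_simps)
    also have "\<dots> = \<Lambda> * snd (q t)"
      using slope[OF that] by (simp add: q_def \<Lambda>_def \<mu>_def \<phi>_def)
    finally show ?thesis .
  qed
  have \<mu>_deriv: "(\<mu> has_real_derivative (\<phi> t)\<^sup>2) (at t within {0..p})" if "t \<in> {0..p}" for t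
    unfolding \<mu>_def \<phi>_def using g[OF that]
    by (auto intro!: derivative_eq_intros simp: power2_eq_square field_simps)
  have \<phi>_cont: "continuous_on {0..p} \<phi>"
    unfolding \<phi>_def using g by (auto intro!: continuous_intros simp: less_le)
  have fst_deriv: "((\<lambda>t. fst (q t)) has_real_derivative fst (w t)) (at t within {0..p})"
    and snd_deriv: "((\<lambda>t. snd (q t)) has_real_derivative snd (w t)) (at t within {0..p})"
    if "t \<in> {0..p}" for t
    unfolding q_def w_def fst_conv snd_conv using D
    by (auto intro!: derivative_eq_intros \<mu>_deriv[OF that])
  have q_deriv: "(q has_vector_derivative w t) (at t within {0..p})" if "t \<in> {0..p}" for t
    using has_vector_derivative_Pair[OF fst_deriv[OF that, unfolded has_real_derivative_iff_has_vector_derivative]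
      snd_deriv[OF that, unfolded has_real_derivative_iff_has_vector_derivative]] by simp
  have vel: "velocity p q t = w t" if "t \<in> {0..p}" for t
    unfolding velocity_def using q_deriv[OF that] p that by (intro vector_derivative_within_closed_interval)
  have ns_w: "null_sum A (w t) = 1" and nd_w: "null_diff A (w t) = (\<phi> t)\<^sup>2" for t
  proof -
    have "\<alpha> * ((\<beta> * u - \<delta>) / D) + \<beta> * (\<gamma> / D + (- \<alpha> / D) * u) = (\<beta> * \<gamma> - \<alpha> * \<delta>) / D"
      "\<gamma> * ((\<beta> * u - \<delta>) / D) + \<delta> * (\<gamma> / D + (- \<alpha> / D) * u) = (\<beta> * \<gamma> - \<alpha> * \<delta>) / D * u" for u
      using D by (simp_all add: field_simps)
    then show "null_sum A (w t) = 1" "null_diff A (w t) = (\<phi> t)\<^sup>2"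
      using D by (simp_all add: ns nd w_def \<eta>_def \<zeta>_def D_eq)
  qed
  have q_Aff: "q t \<in> Aff_plus" if "t \<in> {0..p}" for t
    using Y[OF that] by (simp add: q_def Aff_plus_def \<mu>_def)
  have "\<exists>L. L-lipschitz_on {0..p} (\<lambda>t. fst (q t))" "\<exists>L. L-lipschitz_on {0..p} (\<lambda>t. snd (q t))"
    by (rule C1_imp_lipschitz_on_Icc[OF fst_deriv] C1_imp_lipschitz_on_Icc[OF snd_deriv];
        auto simp: w_def intro!: continuous_intros \<phi>_cont; use D in simp)+
  then obtain L1 L2 where "L1-lipschitz_on {0..p} (\<lambda>t. fst (q t))" "L2-lipschitz_on {0..p} (\<lambda>t. snd (q t))"
    by blast
  from lipschitz_on_Pair[OF this] have q_lip: "\<exists>L. L-lipschitz_on {0..p} q"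
    by auto
  have curve: "nonspacelike_curve A p q"
    unfolding nonspacelike_curve_def
  proof (intro conjI p q_lip AE_I2)
    show "q ` {0..p} \<subseteq> Aff_plus"
      using q_Aff by auto
    fix t assume "t \<in> space (lebesgue_on {0..p})"
    then have t: "t \<in> {0..p}"
      by simp
    show "q differentiable at t within {0..p}"
      using q_deriv[OF t] by (rule differentiableI_vector)
    show "future_nonspacelike A (q t) (velocity p q t)"
      using t by (simp add: future_nonspacelike_iff_null q_Aff vel ns_w nd_w)
  qed
  have from_to: "nonspacelike_from_to A q0 q1 p q"
    using curve xy1 m_eq by (simp add: nonspacelike_from_to_def q_def \<mu>_def prod_eq_iff)

  \<comment> \<open>The potential of the calibration is \<open>\<Lambda> / 2 x + H y\<close>.\<close>
  have "\<alpha> * \<kappa> + \<gamma> / \<kappa> = \<Lambda> * snd q0"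
    using slope'[of 0] p by (simp add: \<phi>_def q_def \<mu>_def)
  then obtain f where f: "continuous_on {0<..} f" "\<And>y. 0 < y \<Longrightarrow> 0 < f y"
    "\<And>y. 0 < y \<Longrightarrow> \<alpha> * f y + \<gamma> / f y = \<Lambda> * y"
    using slope_function_exists[OF sgn nz y0 \<kappa>] by metis
  define h where "h y = (\<beta> * f y + \<delta> / f y) / (2 * y)" for y
  have h: "continuous_on {0<..} h"
    unfolding h_def using f(2) by (intro continuous_intros f(1)) (auto simp: less_le)
  have "isCont h y" if "0 < y" for y
    using h that by (simp add: continuous_on_eq_continuous_at)
  then obtain H where H: "\<And>y. 0 < y \<Longrightarrow> (H has_real_derivative h y) (at y)"
    using einterval_antiderivative[of 0 \<infinity> h]
    by (auto simp: has_real_derivative_iff_has_vector_derivative)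
  have calibration: "(f (snd r) * null_sum A v + null_diff A v / f (snd r)) / (2 * snd r)
      = \<Lambda> / 2 * fst v + h (snd r) * snd v" if r: "r \<in> Aff_plus" for r v
  proof -
    have r: "0 < snd r"
      using r by (auto simp: Aff_plus_def)
    have "f (snd r) * null_sum A v + null_diff A v / f (snd r)
      = (\<alpha> * f (snd r) + \<gamma> / f (snd r)) * fst v + (\<beta> * f (snd r) + \<delta> / f (snd r)) * snd v"
      by (simp add: ns nd add_divide_distrib algebra_simps)
    then show ?thesis
      using r f(3)[OF r] by (simp add: h_def field_simps)
  qed
  have upper: "lorentz_length A t2 r \<le> (\<Lambda> / 2 * fst q1 + H (snd q1)) - (\<Lambda> / 2 * fst q0 + H (snd q0))"
    if "nonspacelike_from_to A q0 q1 t2 r" for t2 r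
    using that H h
  proof (rule lorentz_length_le_calibration)
    fix r v assume r: "r \<in> Aff_plus" and v: "0 \<le> null_sum A v" "0 \<le> null_diff A v"
    have y: "0 < snd r"
      using r by (auto simp: Aff_plus_def)
    have "sqrt (- lorentz_form A r v)
      = sqrt ((f (snd r) * null_sum A v / snd r) * (null_diff A v / f (snd r) / snd r))"
      using f(2)[OF y] by (simp add: lorentz_form_null power2_eq_square)
    also have "\<dots> \<le> (f (snd r) * null_sum A v / snd r + null_diff A v / f (snd r) / snd r) / 2"
      using f(2)[OF y] y v by (intro arith_geo_mean_sqrt) auto
    also have "\<dots> = \<Lambda> / 2 * fst v + h (snd r) * snd v"
      unfolding calibration[OF r, symmetric] by (simp add: add_divide_distrib mult.commute)
    finally show "sqrt (- lorentz_form A r v) \<le> \<Lambda> / 2 * fst v + h (snd r) * snd v" .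
  qed
  have attained: "lorentz_length A p q = (\<Lambda> / 2 * fst q1 + H (snd q1)) - (\<Lambda> / 2 * fst q0 + H (snd q0))"
  proof -
    have "sqrt (- lorentz_form A (q t) (velocity p q t))
      = \<Lambda> / 2 * fst (velocity p q t) + h (snd (q t)) * snd (velocity p q t)" if t: "t \<in> {0..p}" for t
    proof -
      have y: "0 < snd (q t)"
        using q_Aff[OF t] by (auto simp: Aff_plus_def)
      have "f (snd (q t)) = \<phi> t"
        using slope_unique[OF sgn nz f(2)[OF y] \<phi>[OF t]] f(3)[OF y] slope'[OF t] by metis
      then show ?thesis
        unfolding calibration[OF q_Aff[OF t], symmetric] using y \<phi>[OF t]
        by (simp add: lorentz_form_null vel[OF t] ns_w nd_w real_sqrt_divide power2_eq_square)
    qed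
    then have "lorentz_length A p q = (LINT t|lebesgue_on {0..p}.
        \<Lambda> / 2 * fst (velocity p q t) + h (snd (q t)) * snd (velocity p q t))"
      unfolding lorentz_length_def by (intro Bochner_Integration.integral_cong) auto
    then show ?thesis
      using nonspacelike_curve_integral_exact(2)[OF curve H h, of "\<Lambda> / 2"] from_to
      by (simp add: nonspacelike_from_to_def)
  qed
  have "length_maximizer A q0 q1 p q"
    using from_to upper unfolding attained[symmetric] by (rule length_maximizerI)
  then show ?thesis
    by blast
qed

text \<open>The dichotomy is complete because \<open>P\<close> and \<open>M\<close> cannot decrease along the curve that witnesses
membership in the causal future.\<close>

theorem theorem8:
  fixes A :: "real^2^2" and q0 q1 :: "real \<times> real"
  assumes "det A > 0"
    and "sectional_curvature A \<ge> 0"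
    and "q0 \<in> Aff_plus"
    and "q1 \<in> J_plus A q0"
  shows "\<exists>t1 q. length_maximizer A q0 q1 t1 q"
proof -
  obtain t1 q where q: "nonspacelike_from_to A q0 q1 t1 q"
    using assms(4) by (auto simp: J_plus_def)
  then have "q1 \<in> Aff_plus"
    by (force simp: nonspacelike_from_to_def nonspacelike_curve_def)
  show ?thesis
  proof (cases "null_sum A q1 = null_sum A q0 \<or> null_diff A q1 = null_diff A q0")
    case True
    then have "length_maximizer A q0 q1 t1 q"
      using q by (intro length_maximizerI) (auto simp: lorentz_length_eq_0_if_null_constant)
    then show ?thesis
      by blast
  next
    case False
    then show ?thesis
      using nonspacelike_from_to_null_mono[OF q] assms \<open>q1 \<in> Aff_plus\<close>
      by (intro length_maximizer_if_null_increasing) auto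
  qed
qed

end
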